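(* On a qubit, define the POVMs $$M=\left(\tfrac12|0\rangle\langle0|+\tfrac14\mathbf 1,\ \tfrac12|1\rangle\langle1|+\tfrac14\mathbf 1\right),\qquad N_\lambda=\left(\lambda|0\rangle\langle0|,\ \lambda|1\rangle\langle1|,\ (1-\lambda)\mathbf 1\right),\quad \lambda=\tfrac1{64}.$$ Then $M\succeq_{\mathrm{OE}}N_\lambda$, while for the binary ensemble $$\{(\varepsilon,|0\rangle\langle0|),\ (1-\varepsilon,|1\rangle\langle1|)\},\qquad\varepsilon=2^{-64},$$ with letter $U$, one has $I(U;Y_{N_\lambda})>I(U;Y_M)$. Consequently the observational-entropy order $\succeq_{\mathrm{OE}}$ and the all-ensemble mutual-information order $\succeq_{\mathrm{MI}}$ on finite POVMs are inequivalent.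
   Context: For a finite POVM $M=(M_y)$ on $\mathbb C^d$ (zero effects omitted), the observational entropy of a state $\rho$ is $S_M(\rho)=-\sum_y\mathrm{Tr}(\rho M_y)\log\frac{\mathrm{Tr}(\rho M_y)}{\mathrm{Tr}M_y}$. Write $M\succeq_{\mathrm{OE}}N$ if $S_M(\rho)\le S_N(\rho)$ for every state $\rho$. For an ensemble $\{(\pi_u,\rho_u)\}$ of states, $U$ is the letter with distribution $\pi$, $Y_M$ the outcome of measuring $M$ on $\rho_U$, and $I(U;Y_M)$ the mutual information. Write $M\succeq_{\mathrm{MI}}N$ if $I(U;Y_M)\ge I(U;Y_N)$ for every finite ensemble. Here $|0\rangle,|1\rangle$ is the standard basis of $\mathbb C^2$. *)

theory Defs
  imports "HOL-Analysis.Analysis" "HOL-Probability.Probability"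
begin

type_synonym 'n op = "complex^'n^'n"

text \<open>Over the complex numbers, a quadratic form with values in the nonnegative reals forces the
  matrix to be Hermitian, so no separate Hermiticity condition is needed.\<close>

definition pos_semidef :: "'n::finite op \<Rightarrow> bool" where
  "pos_semidef A \<longleftrightarrow> (\<forall>v. (\<Sum>i\<in>UNIV. cnj (v $ i) * (A *v v) $ i) \<in> \<real>\<^sub>\<ge>\<^sub>0)"

definition state :: "'n::finite op \<Rightarrow> bool" where
  "state \<rho> \<longleftrightarrow> pos_semidef \<rho> \<and> trace \<rho> = 1"

text \<open>A finite POVM is the list of its effects; the outcome label is the list position, so
  repeated effects count as distinct outcomes.\<close>

definition povm :: "'n::finite op list \<Rightarrow> bool" where
  "povm M \<longleftrightarrow> (\<forall>A\<in>set M. pos_semidef A \<and> A \<noteq> 0) \<and> sum_list M = mat 1"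

definition ketbra :: "'n::finite \<Rightarrow> 'n op" where
  "ketbra k = (\<chi> i j. axis k 1 $ i * cnj (axis k 1 $ j))"

text \<open>The trace is real for positive semidefinite arguments; the real part only fixes the type.\<close>

definition born :: "'n::finite op \<Rightarrow> 'n op \<Rightarrow> real" where
  "born \<rho> A = Re (trace (\<rho> ** A))"

text \<open>Logarithms are natural throughout. Since \<open>ln 0 = 0\<close>, outcomes of probability zero
  contribute zero.\<close>

definition obs_entropy :: "'n::finite op list \<Rightarrow> 'n op \<Rightarrow> real" where
  "obs_entropy M \<rho> = - (\<Sum>A\<leftarrow>M. born \<rho> A * ln (born \<rho> A / Re (trace A)))"

definition oe_order :: "'n::finite op list \<Rightarrow> 'n op list \<Rightarrow> bool" (infix \<open>\<succeq>OE\<close> 50) where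
  "M \<succeq>OE N \<longleftrightarrow> (\<forall>\<rho>. state \<rho> \<longrightarrow> obs_entropy M \<rho> \<le> obs_entropy N \<rho>)"

text \<open>A finite ensemble is a list of pairs (probability, state); the letter is the list position.\<close>

type_synonym 'n ens = "(real \<times> 'n op) list"

definition ensemble :: "'n::finite ens \<Rightarrow> bool" where
  "ensemble E \<longleftrightarrow> (\<forall>(p, \<rho>)\<in>set E. 0 \<le> p \<and> state \<rho>) \<and> (\<Sum>(p, \<rho>)\<leftarrow>E. p) = 1"

definition letter_pmf :: "'n::finite ens \<Rightarrow> nat pmf" where
  "letter_pmf E = pmf_of_list (zip [0..<length E] (map fst E))"

definition outcome_pmf :: "'n::finite op list \<Rightarrow> 'n op \<Rightarrow> nat pmf" where
  "outcome_pmf M \<rho> = pmf_of_list (zip [0..<length M] (map (born \<rho>) M))"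

definition joint_pmf :: "'n::finite ens \<Rightarrow> 'n op list \<Rightarrow> (nat \<times> nat) pmf" where
  "joint_pmf E M =
     bind_pmf (letter_pmf E) (\<lambda>u. map_pmf (\<lambda>y. (u, y)) (outcome_pmf M (snd (E ! u))))"

text \<open>Mutual information of letter and outcome, the two coordinates of the joint law, in nats.\<close>

definition mutual_info :: "'n::finite ens \<Rightarrow> 'n op list \<Rightarrow> real" where
  "mutual_info E M =
     prob_space.mutual_information (measure_pmf (joint_pmf E M)) (exp 1)
       (count_space UNIV) (count_space UNIV) fst snd"

definition mi_order :: "'n::finite op list \<Rightarrow> 'n op list \<Rightarrow> bool" (infix \<open>\<succeq>MI\<close> 50) where
  "M \<succeq>MI N \<longleftrightarrow> (\<forall>E. ensemble E \<longrightarrow> mutual_info E M \<ge> mutual_info E N)"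

end

theory Submission
  imports Defs
begin

text \<open>Both observational entropies depend only on the diagonal \<open>(p, q)\<close> of the state. With
  \<open>D p = ln 2 - h p\<close> the deficit of the binary entropy \<open>h\<close>, one has
  \<open>S_M = ln 2 - D (1/4 + p/2)\<close> and \<open>S_N = ln 2 - lam * D p\<close>. Since \<open>D p\<close> lies between
  \<open>(p - q)\<^sup>2 / 4\<close> and \<open>(p - q)\<^sup>2\<close>, and \<open>M\<close> halves \<open>p - q\<close>, the order holds once \<open>lam \<le> 1/16\<close>.

  For a letter of small probability \<open>eps\<close>, the information gained by \<open>M\<close> is at most \<open>eps\<close> times the
  relative entropy \<open>ln 3 / 2\<close> of its two output laws, linear in \<open>eps\<close>. The measurement \<open>N\<close> reveals
  the letter exactly with probability \<open>lam\<close> and so gains at least \<open>lam * eps * ln (1 / eps)\<close>, which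
  equals \<open>eps * ln 2\<close> for the given parameters; and \<open>3 < 2\<^sup>2\<close>.\<close>

section \<open>Effects and Born probabilities\<close>

lemma pos_semidef_add:
  assumes "pos_semidef A" "pos_semidef B"
  shows "pos_semidef (A + B)"
proof -
  have "(\<Sum>i\<in>UNIV. cnj (v $ i) * ((A + B) *v v) $ i) =
      (\<Sum>i\<in>UNIV. cnj (v $ i) * (A *v v) $ i) + (\<Sum>i\<in>UNIV. cnj (v $ i) * (B *v v) $ i)" for v
    by (simp add: matrix_vector_mult_add_rdistrib distrib_left sum.distrib)
  with assms show ?thesis
    unfolding pos_semidef_def by simp
qed

lemma pos_semidef_scaleR:
  assumes "pos_semidef A" "0 \<le> c"
  shows "pos_semidef (c *\<^sub>R A)"
proof -
  have "(\<Sum>i\<in>UNIV. cnj (v $ i) * ((c *\<^sub>R A) *v v) $ i) =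
      complex_of_real c * (\<Sum>i\<in>UNIV. cnj (v $ i) * (A *v v) $ i)" for v
    by (simp add: matrix_vector_mult_def sum_distrib_left mult_ac)
      (simp add: scaleR_conv_of_real sum_distrib_left mult_ac)
  with assms show ?thesis
    unfolding pos_semidef_def by simp
qed

lemma pos_semidef_mat_1: "pos_semidef (mat 1)"
  unfolding pos_semidef_def by (simp add: complex_nonneg_Reals_iff sum_nonneg)

lemma ketbra_nth: "ketbra k $ i $ j = (if i = k \<and> j = k then 1 else 0)"
  by (simp add: ketbra_def axis_def)

lemma pos_semidef_ketbra: "pos_semidef (ketbra k)"
proof -
  have "(\<Sum>i\<in>UNIV. cnj (v $ i) * (ketbra k *v v) $ i) = cnj (v $ k) * v $ k" for v
  proof -
    have *: "(ketbra k *v v) $ i = (if i = k then v $ k else 0)" for i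
      by (simp add: matrix_vector_mult_def ketbra_nth if_distrib[of "\<lambda>z. z * _"] cong: if_cong)
    show ?thesis
      by (simp add: * if_distrib cong: if_cong)
  qed
  then show ?thesis
    unfolding pos_semidef_def by (simp add: complex_nonneg_Reals_iff)
qed

lemma trace_scaleR: "trace (c *\<^sub>R A) = c *\<^sub>R trace (A :: 'n::finite op)"
  by (simp add: trace_def scaleR_sum_right)

lemma trace_ketbra: "trace (ketbra k) = 1"
  by (simp add: trace_def ketbra_nth)

lemma state_ketbra: "state (ketbra k)"
  by (simp add: state_def pos_semidef_ketbra trace_ketbra)

text \<open>A diagonal entry is the value of the quadratic form at a basis vector.\<close>

lemma pos_semidef_diag_nonneg:
  assumes "pos_semidef A"
  shows "0 \<le> Re (A $ k $ k)"
proof -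
  have "(\<Sum>i\<in>UNIV. cnj (axis k 1 $ i) * (A *v axis k 1) $ i) = A $ k $ k"
    by (simp add: matrix_vector_mult_def axis_def if_distrib[of cnj] if_distribR
        if_distrib[of "\<lambda>z. z * _"] if_distrib[of "\<lambda>z. _ * z"] cong: if_cong)
  with assms show ?thesis
    unfolding pos_semidef_def by (metis complex_nonneg_Reals_iff)
qed

lemma born_add: "born \<rho> (A + B) = born \<rho> A + born \<rho> B"
  by (simp add: born_def matrix_add_ldistrib trace_add)

lemma born_scaleR: "born \<rho> (c *\<^sub>R A) = c * born \<rho> A"
proof -
  have "\<rho> ** (c *\<^sub>R A) = c *\<^sub>R (\<rho> ** A)"
    by (simp add: vec_eq_iff matrix_matrix_mult_def scaleR_sum_right)
  then show ?thesis
    by (simp add: born_def trace_scaleR)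
qed

lemma born_mat_1: "born \<rho> (mat 1) = Re (trace \<rho>)"
  by (simp add: born_def)

lemma born_ketbra: "born \<rho> (ketbra k) = Re (\<rho> $ k $ k)"
proof -
  have "(\<rho> ** ketbra k) $ i $ i = (if i = k then \<rho> $ k $ k else 0)" for i
    by (simp add: matrix_matrix_mult_def ketbra_nth if_distrib cong: if_cong)
  then show ?thesis
    by (simp add: born_def trace_def)
qed

section \<open>Mutual information as a finite sum\<close>

text \<open>With counting measure as reference, a pmf is the density of its law. This supplies the
  marginal and joint densities that \<open>mutual_information_distr\<close> asks for.\<close>

lemma distributed_measure_pmf:
  "distributed (measure_pmf p) (count_space UNIV) X (\<lambda>x. ennreal (pmf (map_pmf X p) x))"
  by (simp add: distributed_def map_pmf_rep_eq[symmetric] measure_pmf_eq_density[symmetric])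

text \<open>Every term of the integrand carries the factor \<open>pmf P z\<close>, which vanishes
  off \<open>A\<close>, so the integral against counting measure collapses to a finite sum.\<close>

lemma pmf_mutual_information:
  fixes P :: "(nat \<times> nat) pmf"
  assumes "finite A" "set_pmf P \<subseteq> A" "b > 1"
  shows "prob_space.mutual_information (measure_pmf P) b (count_space UNIV) (count_space UNIV) fst snd
    = (\<Sum>z\<in>A. pmf P z * log b (pmf P z / (pmf (map_pmf fst P) (fst z) * pmf (map_pmf snd P) (snd z))))"
proof -
  interpret information_space "measure_pmf P" b
    using assms by unfold_locales
  have pair: "count_space UNIV \<Otimes>\<^sub>M count_space UNIV = count_space (UNIV :: (nat \<times> nat) set)"
    by (simp add: pair_measure_countable)
  have sf: "sigma_finite_measure (count_space (UNIV :: nat set))"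
    by (rule sigma_finite_measure_count_space)
  have XY: "distributed (measure_pmf P) (count_space UNIV \<Otimes>\<^sub>M count_space UNIV)
      (\<lambda>z. (fst z, snd z)) (\<lambda>z. ennreal (pmf P z))"
    using distributed_measure_pmf[of P "\<lambda>z. z"] by (simp add: pair map_pmf_ident)
  let ?f = "\<lambda>z. pmf P z * log b (pmf P z / (pmf (map_pmf fst P) (fst z) * pmf (map_pmf snd P) (snd z)))"
  have "prob_space.mutual_information (measure_pmf P) b (count_space UNIV) (count_space UNIV) fst snd =
      integral\<^sup>L (count_space UNIV) ?f"
    using mutual_information_distr[OF sf sf distributed_measure_pmf _ distributed_measure_pmf _ XY]
    by (simp add: pair)
  also have "\<dots> = (\<Sum>z | ?f z \<noteq> 0. ?f z)"
    using assms by (subst lebesgue_integral_count_space_finite_support)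
      (auto intro: finite_subset[of _ A] simp: set_pmf_iff subset_iff)
  also have "\<dots> = (\<Sum>z\<in>A. ?f z)"
    using assms by (intro sum.mono_neutral_left) (auto simp: set_pmf_iff subset_iff)
  finally show ?thesis .
qed

lemma pmf_of_list_indexed:
  assumes "\<And>x. x \<in> set xs \<Longrightarrow> 0 \<le> x" "sum_list xs = 1"
  shows "pmf (pmf_of_list (zip [0..<length xs] xs)) i = (if i < length xs then xs ! i else 0)"
proof -
  let ?zs = "zip [0..<length xs] xs"
  have "pmf_of_list_wf ?zs"
    using assms by (auto intro!: pmf_of_list_wfI dest: set_zip_rightD)
  then have "pmf (pmf_of_list ?zs) i = (\<Sum>z\<leftarrow>?zs. if fst z = i then snd z else 0)"
    by (simp add: pmf_pmf_of_list sum_list_map_filter')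
  also have "\<dots> = (\<Sum>j = 0..<length xs. if j = i then xs ! j else 0)"
    by (simp add: sum_list_sum_nth)
  finally show ?thesis
    by simp
qed

lemma pmf_bind_Pair:
  "pmf (bind_pmf p (\<lambda>u. map_pmf (Pair u) (K u))) (u, y) = pmf p u * pmf (K u) y"
proof -
  have *: "pmf (map_pmf (Pair v) (K v)) (u, y) = (if v = u then pmf (K u) y else 0)" for v
  proof (cases "v = u")
    case True
    then show ?thesis
      by (simp add: pmf_map_inj' inj_on_def)
  next
    case False
    then show ?thesis
      by (auto simp: pmf_eq_0_set_pmf)
  qed
  have "pmf (bind_pmf p (\<lambda>u. map_pmf (Pair u) (K u))) (u, y) =
      (\<integral>v. (if v = u then pmf (K u) y else 0) \<partial>measure_pmf p)"
    by (simp add: pmf_bind *)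
  also have "\<dots> = pmf p u * pmf (K u) y"
    by (subst integral_measure_pmf[of "{u}"]) (auto split: if_splits)
  finally show ?thesis .
qed

text \<open>The hypotheses ask only for nonnegative, normalised weights and Born probabilities,
  which simplification can check on concrete ensembles and measurements.\<close>

lemma mutual_info_eq_sum:
  fixes E :: "'n::finite ens"
  assumes E: "\<And>z. z \<in> set E \<Longrightarrow> 0 \<le> fst z" "(\<Sum>z\<leftarrow>E. fst z) = 1"
    and K: "\<And>z A. z \<in> set E \<Longrightarrow> A \<in> set M \<Longrightarrow> 0 \<le> born (snd z) A"
      "\<And>z. z \<in> set E \<Longrightarrow> (\<Sum>A\<leftarrow>M. born (snd z) A) = 1"
  defines "p \<equiv> \<lambda>u. fst (E ! u)" and "k \<equiv> \<lambda>u y. born (snd (E ! u)) (M ! y)"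
  shows "mutual_info E M = (\<Sum>u<length E. \<Sum>y<length M.
    p u * k u y * ln (p u * k u y / (p u * (\<Sum>v<length E. p v * k v y))))"
proof -
  let ?m = "length E" and ?n = "length M"
  let ?K = "\<lambda>u. outcome_pmf M (snd (E ! u))"
  let ?P = "joint_pmf E M"
  let ?A = "{..<?m} \<times> {..<?n}"
  have letter: "pmf (letter_pmf E) u = (if u < ?m then p u else 0)" for u
    using pmf_of_list_indexed[of "map fst E" u] E by (force simp: letter_pmf_def p_def)
  have outcome: "pmf (?K u) y = (if y < ?n then k u y else 0)" if "u < ?m" for u y
    using pmf_of_list_indexed[of "map (born (snd (E ! u))) M" y] K(1)[of "E ! u"] K(2)[of "E ! u"] that
    by (force simp: outcome_pmf_def k_def)
  have joint: "pmf ?P (u, y) = (if u < ?m \<and> y < ?n then p u * k u y else 0)" for u y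
    unfolding joint_pmf_def by (simp add: pmf_bind_Pair letter outcome)
  have fst_P: "map_pmf fst ?P = letter_pmf E"
    by (simp add: joint_pmf_def map_bind_pmf map_pmf_comp bind_return_pmf')
  have snd_P: "map_pmf snd ?P = bind_pmf (letter_pmf E) ?K"
    by (simp add: joint_pmf_def map_bind_pmf map_pmf_comp)
  have supp: "set_pmf (letter_pmf E) \<subseteq> {..<?m}"
    by (auto simp: set_pmf_iff letter split: if_splits)
  have marginal: "pmf (map_pmf snd ?P) y = (\<Sum>v<?m. p v * k v y)" if "y < ?n" for y
    unfolding snd_P pmf_bind using supp that
    by (subst integral_measure_pmf[of "{..<?m}"]) (auto simp: letter outcome intro!: sum.cong)
  have "set_pmf ?P \<subseteq> ?A"
    by (auto simp: set_pmf_iff joint split: if_splits)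
  then have "mutual_info E M = (\<Sum>z\<in>?A. pmf ?P z *
      log (exp 1) (pmf ?P z / (pmf (map_pmf fst ?P) (fst z) * pmf (map_pmf snd ?P) (snd z))))"
    unfolding mutual_info_def by (intro pmf_mutual_information) auto
  also have "\<dots> = (\<Sum>(u, y)\<in>?A.
      p u * k u y * ln (p u * k u y / (p u * (\<Sum>v<?m. p v * k v y))))"
    by (intro sum.cong) (auto simp: joint fst_P letter marginal log_def)
  finally show ?thesis
    by (simp add: sum.cartesian_product)
qed

section \<open>Quadratic bounds for the binary entropy deficit\<close>

text \<open>Applying \<open>ln x \<le> x - 1\<close> at \<open>1 / sqrt z\<close> rather than at \<open>1 / z\<close> keeps a quadratic gap
  near \<open>z = 1\<close>.\<close>

lemma xlogx_lower:
  fixes z :: real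
  assumes "0 \<le> z"
  shows "2 * z - 2 * sqrt z \<le> z * ln z"
proof (cases "z = 0")
  case False
  with assms have "0 < z"
    by simp
  then have "z * (- ln (sqrt z)) \<le> z * (1 / sqrt z - 1)"
    using ln_le_minus_one[of "1 / sqrt z"] by (intro mult_left_mono) (auto simp: ln_div)
  moreover have "z * (1 / sqrt z) = sqrt z"
    using \<open>0 < z\<close> by (simp add: real_div_sqrt)
  ultimately show ?thesis
    using \<open>0 < z\<close> by (simp add: ln_sqrt algebra_simps)
qed simp

lemma xlogx_upper:
  fixes z :: real
  assumes "0 \<le> z"
  shows "z * ln z \<le> z * (z - 1)"
  using assms ln_le_minus_one[of z] by (cases "z = 0") (auto intro: mult_left_mono)

lemma xlogx_two:
  fixes z :: real
  shows "0 \<le> z \<Longrightarrow> z * ln (2 * z) = z * ln z + z * ln 2"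
  by (cases "z = 0") (auto simp: ln_mult algebra_simps)

text \<open>\<open>xlogx_lower\<close> at \<open>2 * p\<close> and \<open>2 * q\<close> bounds the
  deficit below by \<open>2 - (s + t)\<close>, where \<open>s\<close> and \<open>t\<close> are the
  square roots of \<open>2 * p\<close> and \<open>2 * q\<close>. With \<open>y = p - q\<close> one
  has \<open>(s * t)^2 = 1 - y^2\<close> and \<open>(s + t)^2 = 2 + 2 * s * t\<close>; completing
  the square after each identity gives \<open>s + t \<le> 2 - y^2 / 4\<close>.\<close>

lemma binary_deficit_lower:
  fixes p q :: real
  assumes "0 \<le> p" "0 \<le> q" "p + q = 1"
  shows "(p - q)\<^sup>2 / 4 \<le> p * ln p + q * ln q + ln 2"
proof -
  define s t where "s = sqrt (2 * p)" and "t = sqrt (2 * q)"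
  have st: "0 \<le> s" "0 \<le> t" "s\<^sup>2 = 2 * p" "t\<^sup>2 = 2 * q"
    using assms by (auto simp: s_def t_def)
  define y where "y = p - q"
  have y: "p = (1 + y) / 2" "q = (1 - y) / 2" "y\<^sup>2 \<le> 1"
    using assms by (auto simp: y_def abs_square_le_1)
  have "(s * t)\<^sup>2 = 1 - y\<^sup>2"
    by (simp add: power_mult_distrib st y) (simp add: power2_eq_square algebra_simps)
  also have "\<dots> \<le> (1 - y\<^sup>2 / 2)\<^sup>2"
    using zero_le_power2[of "y\<^sup>2"] by (simp add: power2_eq_square algebra_simps)
  finally have "s * t \<le> 1 - y\<^sup>2 / 2"
    using y(3) by (intro power2_le_imp_le[of "s * t"]) auto
  then have "(s + t)\<^sup>2 \<le> 4 - y\<^sup>2"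
    using st assms(3) by (simp add: power2_sum)
  also have "\<dots> \<le> (2 - y\<^sup>2 / 4)\<^sup>2"
    using zero_le_power2[of "y\<^sup>2"] by (simp add: power2_eq_square algebra_simps)
  finally have "s + t \<le> 2 - y\<^sup>2 / 4"
    using y(3) by (intro power2_le_imp_le[of "s + t"]) auto
  moreover have "2 * p - s \<le> p * ln p + p * ln 2" "2 * q - t \<le> q * ln q + q * ln 2"
    using xlogx_lower[of "2 * p"] xlogx_lower[of "2 * q"] xlogx_two[of p] xlogx_two[of q] assms
    by (auto simp: s_def t_def)
  moreover have "p * ln 2 + q * ln 2 = ln 2"
    using assms(3) by (simp flip: distrib_right)
  ultimately show ?thesis
    using assms(3) unfolding y_def by linarith
qed

text \<open>The deficit is the relative entropy to the uniform law, and
  \<open>ln x \<le> x - 1\<close> bounds it by the chi-squared divergence, here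
  \<open>(p - q)^2\<close>.\<close>

lemma binary_deficit_upper:
  fixes p q :: real
  assumes "0 \<le> p" "0 \<le> q" "p + q = 1"
  shows "p * ln p + q * ln q + ln 2 \<le> (p - q)\<^sup>2"
proof -
  have "p * ln p + p * ln 2 \<le> p * (2 * p - 1)" "q * ln q + q * ln 2 \<le> q * (2 * q - 1)"
    using xlogx_upper[of "2 * p"] xlogx_upper[of "2 * q"] xlogx_two[of p] xlogx_two[of q] assms
    by auto
  moreover have "p * ln 2 + q * ln 2 = ln 2"
    using assms(3) by (simp flip: distrib_right)
  moreover have "p * (2 * p - 1) + q * (2 * q - 1) = (p - q)\<^sup>2"
  proof -
    have q: "q = 1 - p"
      using assms(3) by simp
    show ?thesis
      unfolding q by (simp add: power2_eq_square algebra_simps)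
  qed
  ultimately show ?thesis
    by linarith
qed

section \<open>The separating pair of measurements\<close>

lemma noisy_basis_oe_erased_basis:
  fixes lam :: real
  assumes lam: "0 < lam" "lam \<le> 1 / 16"
  shows "[(1/2) *\<^sub>R ketbra 0 + (1/4) *\<^sub>R mat 1, (1/2) *\<^sub>R ketbra 1 + (1/4) *\<^sub>R mat 1] \<succeq>OE
    [lam *\<^sub>R ketbra 0, lam *\<^sub>R ketbra 1, (1 - lam) *\<^sub>R mat 1 :: 2 op]"
  unfolding oe_order_def
proof (intro allI impI)
  fix \<rho> :: "2 op"
  assume \<rho>: "state \<rho>"
  define p q where "p = Re (\<rho> $ 0 $ 0)" and "q = Re (\<rho> $ 1 $ 1)"
  have tr: "Re (trace \<rho>) = 1"
    using \<rho> by (simp add: state_def)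
  have "0 \<le> p" "0 \<le> q"
    using \<rho> by (auto simp: p_def q_def state_def pos_semidef_diag_nonneg)
  moreover have "p + q = 1"
  proof -
    \<comment> \<open>\<open>UNIV_2\<close> lists the two indices as 1 and 2, and numerals of type
      \<open>2\<close> are taken modulo 2.\<close>
    have two: "(2::2) = 0"
      by simp
    show ?thesis
      using tr
      by (simp add: trace_def UNIV_2 two p_def q_def)
  qed
  ultimately have pq: "0 \<le> p" "0 \<le> q" "p + q = 1"
    by auto
  define a b where "a = p / 2 + 1 / 4" and "b = q / 2 + 1 / 4"
  have ab: "0 \<le> a" "0 \<le> b" "a + b = 1" "a - b = (p - q) / 2"
    using pq by (auto simp: a_def b_def field_simps)
  \<comment> \<open>Both effects have trace 1, so the logarithms are of the bare outcome
    probabilities \<open>a\<close> and \<open>b\<close>.\<close>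
  have "obs_entropy [(1/2) *\<^sub>R ketbra 0 + (1/4) *\<^sub>R mat 1, (1/2) *\<^sub>R ketbra 1 + (1/4) *\<^sub>R mat 1] \<rho> =
      - (a * ln a + b * ln b)"
    by (simp add: obs_entropy_def born_add born_scaleR born_ketbra born_mat_1 tr trace_add
        trace_scaleR trace_ketbra trace_I a_def b_def p_def q_def)
  also have "\<dots> \<le> ln 2 - (p - q)\<^sup>2 / 16"
    using binary_deficit_lower[OF ab(1-3)] by (simp add: ab(4) power_divide)
  also have "\<dots> \<le> ln 2 - lam * (p - q)\<^sup>2"
    using lam mult_right_mono[of lam "1 / 16" "(p - q)\<^sup>2"] by simp
  also have "\<dots> \<le> ln 2 - lam * (p * ln p + q * ln q + ln 2)"
    using lam binary_deficit_upper[OF pq] by (simp add: mult_left_mono)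
  \<comment> \<open>Dividing by the traces \<open>lam\<close>, \<open>lam\<close> and
    \<open>2 * (1 - lam)\<close> leaves the ratios \<open>p\<close>, \<open>q\<close> and
    1/2.\<close>
  also have "\<dots> = - (lam * p * ln p + (lam * q * ln q + (1 - lam) * ln (1 / 2)))"
    by (simp add: ln_div algebra_simps)
  also have "\<dots> = obs_entropy [lam *\<^sub>R ketbra 0, lam *\<^sub>R ketbra 1, (1 - lam) *\<^sub>R mat 1] \<rho>"
    using lam by (simp add: obs_entropy_def born_scaleR born_ketbra born_mat_1 tr trace_scaleR
        trace_ketbra trace_I p_def q_def)
  finally show "obs_entropy [(1/2) *\<^sub>R ketbra 0 + (1/4) *\<^sub>R mat 1,
      (1/2) *\<^sub>R ketbra 1 + (1/4) *\<^sub>R mat 1] \<rho> \<le>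
    obs_entropy [lam *\<^sub>R ketbra 0, lam *\<^sub>R ketbra 1, (1 - lam) *\<^sub>R mat 1] \<rho>" .
qed

text \<open>The third outcome is equally likely under both letters and contributes nothing; the
  other two identify the letter. The information is therefore \<open>lam\<close> times the entropy
  of the letter, of which only the term of the rare letter is kept.\<close>

lemma mutual_info_erased_basis_ge:
  fixes lam eps :: real
  assumes "0 < lam" "lam < 1" "0 < eps" "eps < 1"
  shows "lam * eps * ln (1 / eps) \<le> mutual_info [(eps, ketbra 0), (1 - eps, ketbra 1)]
    [lam *\<^sub>R ketbra 0, lam *\<^sub>R ketbra 1, (1 - lam) *\<^sub>R mat 1 :: 2 op]"
proof -
  have "mutual_info [(eps, ketbra 0), (1 - eps, ketbra 1)]
      [lam *\<^sub>R ketbra 0, lam *\<^sub>R ketbra 1, (1 - lam) *\<^sub>R mat 1 :: 2 op] =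
      eps * lam * ln (eps * lam / (eps * (eps * lam))) +
      eps * (1 - lam) * ln (eps * (1 - lam) / (eps * (eps * (1 - lam) + (1 - eps) * (1 - lam)))) +
      ((1 - eps) * lam * ln ((1 - eps) * lam / ((1 - eps) * ((1 - eps) * lam))) +
      (1 - eps) * (1 - lam) *
        ln ((1 - eps) * (1 - lam) / ((1 - eps) * (eps * (1 - lam) + (1 - eps) * (1 - lam)))))"
    using assms by (subst mutual_info_eq_sum)
      (auto simp: born_scaleR born_ketbra born_mat_1 ketbra_nth trace_ketbra
        lessThan_Suc eval_nat_numeral add.commute)
  also have "\<dots> = eps * lam * ln (1 / eps) + (1 - eps) * lam * ln (1 / (1 - eps))"
  proof -
    have "eps * (1 - lam) + (1 - eps) * (1 - lam) = 1 - lam"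
      by (simp add: algebra_simps)
    then show ?thesis
      using assms by simp
  qed
  finally have "mutual_info [(eps, ketbra 0), (1 - eps, ketbra 1)]
      [lam *\<^sub>R ketbra 0, lam *\<^sub>R ketbra 1, (1 - lam) *\<^sub>R mat 1 :: 2 op] =
      eps * lam * ln (1 / eps) + (1 - eps) * lam * ln (1 / (1 - eps))" .
  moreover have "0 \<le> (1 - eps) * lam * ln (1 / (1 - eps))"
    using assms by (intro mult_nonneg_nonneg) auto
  ultimately show ?thesis
    by (simp add: mult_ac)
qed

text \<open>Replacing the true output law by that of the likely letter can only increase the averaged
  relative entropy, which then reduces to \<^term>\<open>eps\<close> times the relative entropy between the two
  output laws.\<close>

lemma mutual_info_noisy_basis_le:
  fixes eps :: real
  assumes "0 < eps" "eps < 1"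
  shows "mutual_info [(eps, ketbra 0), (1 - eps, ketbra 1)]
    [(1/2) *\<^sub>R ketbra 0 + (1/4) *\<^sub>R mat 1, (1/2) *\<^sub>R ketbra 1 + (1/4) *\<^sub>R mat 1 :: 2 op]
    \<le> eps * (ln 3 / 2)"
proof -
  define a b where "a = eps * (3/4) + (1 - eps) * (1/4)" and "b = eps * (1/4) + (1 - eps) * (3/4)"
  have ab: "0 < a" "0 < b" "a + b = 1"
    using assms by (auto simp: a_def b_def add_pos_pos field_simps)
  have "mutual_info [(eps, ketbra 0), (1 - eps, ketbra 1)]
      [(1/2) *\<^sub>R ketbra 0 + (1/4) *\<^sub>R mat 1, (1/2) *\<^sub>R ketbra 1 + (1/4) *\<^sub>R mat 1 :: 2 op] =
      eps * (3/4) * ln (3/4 / a) + eps * (1/4) * ln (1/4 / b) +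
      ((1 - eps) * (1/4) * ln (1/4 / a) + (1 - eps) * (3/4) * ln (3/4 / b))"
    using assms by (subst mutual_info_eq_sum)
      (auto simp: born_add born_scaleR born_ketbra born_mat_1 ketbra_nth trace_ketbra
        lessThan_Suc eval_nat_numeral a_def b_def add.commute)
  also have "\<dots> = eps * (ln 3 / 2) + (a * ln (1/4 / a) + b * ln (3/4 / b))"
  proof -
    \<comment> \<open>Under the rare letter, passing to the output law (1/4, 3/4) of the likely one
      shifts the two logarithms by \<open>ln 3\<close> and \<open>- ln 3\<close>; with weights 3/4
      and 1/4 the net shift is \<open>ln 3 / 2\<close>.\<close>
    have ln3: "ln (3/4 / a) = ln 3 + ln (1/4 / a)" "ln (1/4 / b) = ln (3/4 / b) - ln 3"
      using ab by (auto simp: ln_div ln_mult)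
    have "eps * (3/4) * (l + r) + eps * (1/4) * (s - l) +
        ((1 - eps) * (1/4) * r + (1 - eps) * (3/4) * s) = eps * (l / 2) + (a * r + b * s)"
      for l r s :: real
      by (simp add: a_def b_def field_simps)
    then show ?thesis
      by (simp only: ln3)
  qed
  \<comment> \<open>The left side is minus the relative entropy of \<open>(a, b)\<close> to (1/4,
    3/4), hence nonpositive.\<close>
  also have "a * ln (1/4 / a) + b * ln (3/4 / b) \<le> a * (1/4 / a - 1) + b * (3/4 / b - 1)"
    using ab by (intro add_mono mult_left_mono ln_le_minus_one) auto
  also have "\<dots> = 0"
    using ab by (simp add: right_diff_distrib)
  finally show ?thesis
    by simp
qed

theorem theorem11p6:
  fixes M N :: "2 op list" and E :: "2 ens" and lam eps :: real
  assumes lam: "lam = 1 / 64"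
    and eps: "eps = 1 / 2 ^ 64"
    and M: "M = [(1/2) *\<^sub>R ketbra 0 + (1/4) *\<^sub>R mat 1,
                 (1/2) *\<^sub>R ketbra 1 + (1/4) *\<^sub>R mat 1]"
    and N: "N = [lam *\<^sub>R ketbra 0, lam *\<^sub>R ketbra 1, (1 - lam) *\<^sub>R mat 1]"
    and E: "E = [(eps, ketbra 0), (1 - eps, ketbra 1)]"
  shows "povm M \<and> povm N \<and> M \<succeq>OE N \<and>
    ensemble E \<and> mutual_info E N > mutual_info E M \<and>
    \<not> (\<forall>A B :: 2 op list. povm A \<longrightarrow> povm B \<longrightarrow> (A \<succeq>OE B \<longleftrightarrow> A \<succeq>MI B))"
proof -
  have eps01: "0 < eps" "eps < 1"
    by (auto simp: eps)
  have lam01: "0 < lam" "lam < 1" "lam \<le> 1 / 16"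
    by (auto simp: lam)
  have sum_ketbra: "ketbra 0 + ketbra 1 = (mat 1 :: 2 op)"
    by (auto simp: vec_eq_iff forall_2 ketbra_nth mat_def)
  have nz: "A \<noteq> 0" if "trace A \<noteq> 0" for A :: "2 op"
    using that by (auto simp: trace_def)
  have "povm M"
  proof -
    have "sum_list M = (1/2) *\<^sub>R (ketbra 0 + ketbra 1) + (1/2) *\<^sub>R mat 1"
      by (simp add: M algebra_simps flip: scaleR_left.add)
    also have "\<dots> = mat 1"
      by (simp add: sum_ketbra flip: scaleR_left.add)
    finally have "sum_list M = mat 1" .
    moreover have "A \<noteq> 0 \<and> pos_semidef A" if "A \<in> set M" for A
      using that
      by (auto simp: M trace_add trace_scaleR trace_ketbra trace_I complex_eq_iff
          intro!: pos_semidef_add pos_semidef_scaleR pos_semidef_ketbra pos_semidef_mat_1 nz)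
    ultimately show ?thesis
      by (simp add: povm_def)
  qed
  moreover have "povm N"
  proof -
    have "sum_list N = lam *\<^sub>R (ketbra 0 + ketbra 1) + (1 - lam) *\<^sub>R mat 1"
      by (simp add: N scaleR_right_distrib)
    also have "\<dots> = mat 1"
      by (simp add: sum_ketbra flip: scaleR_left.add)
    finally show ?thesis
      using lam01
      by (auto simp: povm_def N trace_scaleR trace_ketbra trace_I
          intro!: pos_semidef_scaleR pos_semidef_ketbra pos_semidef_mat_1 nz)
  qed
  moreover have "M \<succeq>OE N"
    unfolding M N using lam01 by (intro noisy_basis_oe_erased_basis)
  moreover have "ensemble E"
    using eps01 by (simp add: ensemble_def E state_ketbra)
  moreover have "mutual_info E N > mutual_info E M"
  proof -
    \<comment> \<open>The exponent 64 is \<open>1 / lam\<close>, so the factor \<open>lam\<close>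
      cancels.\<close>
    have "ln (1 / eps) = 64 * ln 2"
      by (simp add: eps ln_realpow del: power_numeral)
    then have "lam * eps * ln (1 / eps) = eps * ln 2"
      by (simp add: lam)
    moreover have "ln 3 / 2 < ln (2::real)"
    proof -
      have "ln 3 < ln (2 ^ 2 :: real)"
        by simp
      then show ?thesis
        by (simp add: ln_realpow del: power_numeral)
    qed
    then have "eps * (ln 3 / 2) < eps * ln 2"
      using eps01 by simp
    ultimately show ?thesis
      using mutual_info_noisy_basis_le[OF eps01] mutual_info_erased_basis_ge[OF lam01(1,2) eps01]
      unfolding M N E by linarith
  qed
  \<comment> \<open>The pair \<open>M\<close>, \<open>N\<close> refutes the equivalence, with
    \<open>E\<close> witnessing the failure of the information order.\<close>
  ultimately show ?thesis
    unfolding mi_order_def by (metis not_less)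
qed

end
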